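(* Let $\rho>0$ and $\mathbf u$ be smooth fields on $\Omega\times I$ satisfying the continuity equation $\partial_t\rho+\mathbf u\cdot\nabla\rho=-\rho\,\nabla\cdot\mathbf u$ in $\Omega$ for all $t\in I$. Let $\langle\rho_h\rangle$ and $\widetilde{\mathbf u}_h$ be the filtered density and filtered velocity on $U_h\times I$, and let $\frac{d}{dt}=\frac{\partial}{\partial t}+\widetilde{\mathbf u}_h\cdot\nabla$ be the material derivative along the filtered velocity. Then for all $\mathbf r\in U_h$ and $t\in I$ the filtered continuity equation holds in integro-differential form, $$\frac{d}{dt}\langle\rho_h(\mathbf r)\rangle=\int_{\Omega_h(\mathbf r)}\rho(\mathbf r')\big(\widetilde{\mathbf u}_h(\mathbf r)-\mathbf u(\mathbf r')\big)\cdot\nabla w_h(\mathbf r-\mathbf r')\,d^n\mathbf r',$$ and, equivalently, in differential form, $$\frac{d}{dt}\langle\rho_h(\mathbf r)\rangle=-\langle\rho_h(\mathbf r)\rangle\,\nabla\cdot\widetilde{\mathbf u}_h(\mathbf r).$$ Here the dependence of all fields on $t$ is suppressed.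
   Context: Let $\Omega\subseteq\mathbb R^n$ be an open set (the fluid domain), $I\subseteq\mathbb R$ an open time interval, $h>0$ a fixed filter length and $\kappa>0$ a fixed constant. The filter (kernel) $w_h\in C_c^\infty(\mathbb R^n)$ is real-valued, satisfies $w_h\ge 0$ and $\int_{\mathbb R^n}w_h=1$, and is supported in the closed ball of radius $\kappa h$ about $0$. For a point $\mathbf r$, the test space is $\Omega_h(\mathbf r)=\{\mathbf r':\|\mathbf r-\mathbf r'\|\le\kappa h\}$; set $U_h=\{\mathbf r\in\Omega:\Omega_h(\mathbf r)\subset\Omega\}$, the open set of points whose test space lies within the fluid domain. For $\mathbf r\in U_h$ the filtered density and filtered (density-weighted) velocity are defined by $$\langle\rho_h(\mathbf r)\rangle=\int_{\Omega_h(\mathbf r)}\rho(\mathbf r')w_h(\mathbf r-\mathbf r')\,d^n\mathbf r',\qquad \langle\rho_h(\mathbf r)\rangle\,\widetilde{\mathbf u}_h(\mathbf r)=\int_{\Omega_h(\mathbf r)}\rho(\mathbf r')\mathbf u(\mathbf r')w_h(\mathbf r-\mathbf r')\,d^n\mathbf r'.$$ In the integrals $\nabla w_h(\mathbf r-\mathbf r')$ denotes the gradient with respect to $\mathbf r$ of $w_h(\mathbf r-\mathbf r')$. *)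

theory Defs
  imports "HOL-Analysis.Analysis"
begin

primrec Ck_on :: "nat \<Rightarrow> 'a::euclidean_space set \<Rightarrow> ('a \<Rightarrow> 'b::euclidean_space) \<Rightarrow> bool" where
  "Ck_on 0 S f \<longleftrightarrow> continuous_on S f"
| "Ck_on (Suc k) S f \<longleftrightarrow>
     (\<forall>x\<in>S. f differentiable (at x)) \<and> (\<forall>v. Ck_on k S (\<lambda>x. frechet_derivative f (at x) v))"

text \<open>Meant for open \<open>S\<close> only, since the derivatives are taken in the full space.\<close>

definition smooth_on :: "'a::euclidean_space set \<Rightarrow> ('a \<Rightarrow> 'b::euclidean_space) \<Rightarrow> bool" where
  "smooth_on S f \<longleftrightarrow> (\<forall>k. Ck_on k S f)"

definition gradient :: "(real ^ 'n \<Rightarrow> real) \<Rightarrow> real ^ 'n \<Rightarrow> real ^ 'n" where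
  "gradient f x = (\<chi> i. frechet_derivative f (at x) (axis i 1))"

definition divergence :: "(real ^ 'n \<Rightarrow> real ^ 'n) \<Rightarrow> real ^ 'n \<Rightarrow> real" where
  "divergence v x = (\<Sum>i\<in>UNIV. frechet_derivative v (at x) (axis i 1) $ i)"

text \<open>Time-dependent fields take the position first and the time second.\<close>

definition material_derivative ::
  "(real ^ 'n \<Rightarrow> real \<Rightarrow> real ^ 'n) \<Rightarrow> (real ^ 'n \<Rightarrow> real \<Rightarrow> real) \<Rightarrow> real ^ 'n \<Rightarrow> real \<Rightarrow> real" where
  "material_derivative v f r t = deriv (\<lambda>s. f r s) t + v r t \<bullet> gradient (\<lambda>x. f x t) r"

definition filter_kernel :: "real \<Rightarrow> real \<Rightarrow> (real ^ 'n \<Rightarrow> real) \<Rightarrow> bool" where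
  "filter_kernel \<kappa> h w \<longleftrightarrow>
     smooth_on UNIV w \<and> (\<forall>x. 0 \<le> w x) \<and> (\<integral>x. w x \<partial>lborel) = 1 \<and>
     closure {x. w x \<noteq> 0} \<subseteq> cball 0 (\<kappa> * h)"

definition test_space :: "real \<Rightarrow> real \<Rightarrow> real ^ 'n \<Rightarrow> (real ^ 'n) set" where
  "test_space \<kappa> h r = {r'. norm (r - r') \<le> \<kappa> * h}"

definition interior_domain :: "real \<Rightarrow> real \<Rightarrow> (real ^ 'n) set \<Rightarrow> (real ^ 'n) set" where
  "interior_domain \<kappa> h \<Omega> = {r \<in> \<Omega>. test_space \<kappa> h r \<subseteq> \<Omega>}"

definition filtered_density ::
  "real \<Rightarrow> real \<Rightarrow> (real ^ 'n \<Rightarrow> real) \<Rightarrow> (real ^ 'n \<Rightarrow> real \<Rightarrow> real) \<Rightarrow> real ^ 'n \<Rightarrow> real \<Rightarrow> real" where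
  "filtered_density \<kappa> h w \<rho> r t = (LINT r':test_space \<kappa> h r|lborel. \<rho> r' t * w (r - r'))"

text \<open>The filtered velocity is defined implicitly by
  \<open>filtered_density *\<^sub>R filtered_velocity = LINT \<rho> u w\<close>; this determines it because the filtered
  density is positive on \<open>interior_domain\<close> when \<open>\<rho> > 0\<close>.\<close>

definition filtered_velocity ::
  "real \<Rightarrow> real \<Rightarrow> (real ^ 'n \<Rightarrow> real) \<Rightarrow> (real ^ 'n \<Rightarrow> real \<Rightarrow> real) \<Rightarrow>
    (real ^ 'n \<Rightarrow> real \<Rightarrow> real ^ 'n) \<Rightarrow> real ^ 'n \<Rightarrow> real \<Rightarrow> real ^ 'n" where
  "filtered_velocity \<kappa> h w \<rho> u r t =
     (LINT r':test_space \<kappa> h r|lborel. (\<rho> r' t * w (r - r')) *\<^sub>R u r' t)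
       /\<^sub>R filtered_density \<kappa> h w \<rho> r t"

end

theory Submission
  imports Defs
begin

text \<open>
  A filtered field \<open>\<integral> w (x - y) G (y) dy\<close> can also be written \<open>\<integral> w (z) G (x - z) dz\<close>. Differentiating
  the second form puts the derivative on \<open>G\<close>, differentiating the first puts it on \<open>w\<close>. With \<open>m\<close> the
  filtered momentum \<open>\<integral> w \<rho> u\<close>, the second form applied to \<open>\<rho>\<close> and \<open>\<rho> u\<close> turns the pointwise
  continuity equation into \<open>\<partial>\<^sub>t \<rho>\<^sub>h + div m = 0\<close>; the first form then expresses \<open>div m\<close> and
  \<open>grad \<rho>\<^sub>h\<close> through \<open>grad w\<close>. Uniqueness of the derivative thus replaces integration by parts.
  The differential form is the quotient rule for \<open>u\<^sub>h = m / \<rho>\<^sub>h\<close>.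
\<close>

section \<open>Set integrals: linearity, and reflection of compact domains\<close>

lemma set_integrable_lborel_compact:
  fixes f :: "'a::euclidean_space \<Rightarrow> 'b::euclidean_space"
  assumes "compact K" "continuous_on K f"
  shows "set_integrable lborel K f"
  using borel_integrable_compact[OF assms] by (simp add: set_integrable_def)

lemma set_integral_bounded_linear:
  fixes f :: "'a \<Rightarrow> 'b::{banach, second_countable_topology}"
    and T :: "'b \<Rightarrow> 'c::{banach, second_countable_topology}"
  assumes "bounded_linear T" "set_integrable M A f"
  shows "(LINT x:A|M. T (f x)) = T (LINT x:A|M. f x)"
proof -
  interpret bounded_linear T by fact
  show ?thesis
    using integral_bounded_linear[OF assms(1), of M "\<lambda>x. indicator A x *\<^sub>R f x"] assms(2)
    by (simp add: set_lebesgue_integral_def set_integrable_def scaleR)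
qed

lemma set_integral_sum:
  fixes f :: "'i \<Rightarrow> 'a \<Rightarrow> 'b::{banach, second_countable_topology}"
  assumes "\<And>i. i \<in> S \<Longrightarrow> set_integrable M A (f i)"
  shows "(LINT x:A|M. (\<Sum>i\<in>S. f i x)) = (\<Sum>i\<in>S. LINT x:A|M. f i x)"
  using assms by (simp add: set_lebesgue_integral_def set_integrable_def scaleR_sum_right)

text \<open>Lebesgue measure is invariant under the point reflection
  \<open>z \<mapsto> r - z\<close>, an affine map with factor -1. Continuity on the compact set
  makes the integrand, cut off outside \<open>K\<close>, measurable. This passes between the two
  forms of a filtered field.\<close>

lemma set_integral_lborel_reflect:
  fixes f :: "'a::euclidean_space \<Rightarrow> 'b::euclidean_space"
  assumes "compact K" "continuous_on K f"
  shows "(LINT y:K|lborel. f y) = (LINT z:(\<lambda>y. r - y) ` K|lborel. f (r - z))"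
proof -
  have lborel_reflect: "lborel = distr lborel borel (\<lambda>z::'a. r - z)"
    using lborel_affine[of "- 1" r] by (simp add: density_1)
  have meas: "(\<lambda>y. indicator K y *\<^sub>R f y) \<in> borel_measurable borel"
    using borel_integrable_compact[OF assms] by (simp add: borel_measurable_integrable)
  have ind: "indicator ((\<lambda>y. r - y) ` K) z = (indicator K (r - z) :: real)" for z
    by (auto simp: indicator_def image_iff) (metis diff_add_cancel add_diff_cancel_left')
  have "(LINT y:K|lborel. f y) = (\<integral>y. indicator K y *\<^sub>R f y \<partial>distr lborel borel (\<lambda>z. r - z))"
    by (subst lborel_reflect[symmetric]) (simp add: set_lebesgue_integral_def)
  also have "\<dots> = (\<integral>z. indicator K (r - z) *\<^sub>R f (r - z) \<partial>lborel)"
    by (rule integral_distr) (use meas in auto)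
  finally show ?thesis
    by (simp add: set_lebesgue_integral_def ind)
qed

section \<open>Differentiation under the integral sign\<close>

text \<open>Compactness of \<open>K\<close> makes the derivative in \<open>p\<close> close to its
  value at \<open>p0\<close> uniformly in \<open>y\<close>. The mean value inequality then bounds
  the linearization error uniformly, and integrating over the finite measure of \<open>K\<close>
  keeps it small compared with \<open>norm (p - p0)\<close>.\<close>

lemma has_derivative_set_integral_compact:
  fixes f :: "'p::euclidean_space \<Rightarrow> 'a::euclidean_space \<Rightarrow> 'b::euclidean_space"
  assumes "open U" "p0 \<in> U" "compact K"
    and f': "\<And>p y. p \<in> U \<Longrightarrow> y \<in> K \<Longrightarrow> ((\<lambda>p. f p y) has_derivative f' p y) (at p)"
    and cont_f: "\<And>p. p \<in> U \<Longrightarrow> continuous_on K (f p)"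
    and cont_f': "\<And>v. continuous_on (U \<times> K) (\<lambda>(p, y). f' p y v)"
  shows "((\<lambda>p. LINT y:K|lborel. f p y) has_derivative (\<lambda>v. LINT y:K|lborel. f' p0 y v)) (at p0)"
proof -
  \<comment> \<open>Bundling the derivatives as bounded linear maps gives access to the operator
    norm. In finite dimension, continuity in each direction implies continuity in that norm.\<close>
  define F where "F = (\<lambda>(p, y). Blinfun (f' p y))"
  have F: "blinfun_apply (F (p, y)) = f' p y" if "p \<in> U" "y \<in> K" for p y
    using f'[OF that] by (simp add: F_def has_derivative_bounded_linear bounded_linear_Blinfun_apply)
  have cont_F: "continuous_on (U \<times> K) F"
  proof (rule continuous_on_blinfun_componentwise)
    fix i :: 'p
    show "continuous_on (U \<times> K) (\<lambda>x. blinfun_apply (F x) i)"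
      by (rule continuous_on_eq[OF cont_f'[of i]]) (auto simp: F)
  qed
  have int_f: "set_integrable lborel K (f p)" if "p \<in> U" for p
    by (rule set_integrable_lborel_compact[OF \<open>compact K\<close> cont_f[OF that]])
  have int_f': "set_integrable lborel K (\<lambda>y. f' p0 y v)" for v
  proof (rule set_integrable_lborel_compact[OF \<open>compact K\<close>])
    have "continuous_on K (\<lambda>y. (p0, y))"
      by (intro continuous_intros)
    from continuous_on_compose2[OF cont_f'[of v] this]
    show "continuous_on K (\<lambda>y. f' p0 y v)"
      using \<open>p0 \<in> U\<close> by auto
  qed
  have lin_f': "linear (f' p0 y)" if "y \<in> K" for y
    using f'[OF \<open>p0 \<in> U\<close> that] by (simp add: has_derivative_linear)
  have "linear (\<lambda>v. LINT y:K|lborel. f' p0 y v)"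
  proof (rule linearI)
    fix a b
    have "(LINT y:K|lborel. f' p0 y (a + b)) = (LINT y:K|lborel. f' p0 y a + f' p0 y b)"
      using \<open>compact K\<close> by (intro set_lebesgue_integral_cong) (auto simp: linear_add[OF lin_f'] compact_imp_closed)
    then show "(LINT y:K|lborel. f' p0 y (a + b)) = (LINT y:K|lborel. f' p0 y a) + (LINT y:K|lborel. f' p0 y b)"
      by (simp add: set_integral_add int_f')
  next
    fix c :: real and a
    have "(LINT y:K|lborel. f' p0 y (c *\<^sub>R a)) = (LINT y:K|lborel. c *\<^sub>R f' p0 y a)"
      using \<open>compact K\<close> by (intro set_lebesgue_integral_cong) (auto simp: linear_scale[OF lin_f'] compact_imp_closed)
    then show "(LINT y:K|lborel. f' p0 y (c *\<^sub>R a)) = c *\<^sub>R (LINT y:K|lborel. f' p0 y a)"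
      by simp
  qed
  then have bl: "bounded_linear (\<lambda>v. LINT y:K|lborel. f' p0 y v)"
    by (simp add: linear_conv_bounded_linear)
  show ?thesis
    unfolding has_derivative_at_alt
  proof (intro conjI allI impI)
    show "bounded_linear (\<lambda>v. LINT y:K|lborel. f' p0 y v)" by (rule bl)
    fix e :: real assume "e > 0"
    define m where "m = measure lborel K"
    have "m \<ge> 0" by (simp add: m_def)
    \<comment> \<open>Chosen so that \<open>e' * m \<le> e\<close>; the summand 1 avoids division by
      zero when \<open>K\<close> is a null set.\<close>
    define e' where "e' = e / (m + 1)"
    have "e' > 0" using \<open>e > 0\<close> \<open>m \<ge> 0\<close> by (simp add: e'_def)
    \<comment> \<open>Tube argument: one neighbourhood of \<open>p0\<close> serves all
      \<open>y \<in> K\<close>.\<close>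
    obtain X0 where X0: "p0 \<in> X0" "open X0"
      and close: "\<And>p y. p \<in> X0 \<inter> U \<Longrightarrow> y \<in> K \<Longrightarrow> dist (F (p, y)) (F (p0, y)) \<le> e'"
      using continuous_on_prod_compactE[OF cont_F \<open>compact K\<close> \<open>p0 \<in> U\<close> \<open>e' > 0\<close>] by metis
    obtain d where d: "d > 0" "ball p0 d \<subseteq> X0 \<inter> U"
      using openE[of "X0 \<inter> U" p0] X0 \<open>open U\<close> \<open>p0 \<in> U\<close> by blast
    have main: "norm ((LINT y:K|lborel. f p y) - (LINT y:K|lborel. f p0 y) - (LINT y:K|lborel. f' p0 y (p - p0)))
        \<le> e * norm (p - p0)" if "norm (p - p0) < d" for p
    proof -
      have pb: "p \<in> ball p0 d" using that by (simp add: dist_norm norm_minus_commute)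
      then have "p \<in> U" using d by blast
      \<comment> \<open>Mean value inequality on a ball, whose convexity keeps the segment from
        \<open>p0\<close> to \<open>p\<close> inside the region where the derivatives are
        close.\<close>
      have pw: "norm (f p y - f p0 y - f' p0 y (p - p0)) \<le> norm (p - p0) * e'" if "y \<in> K" for y
      proof (rule differentiable_bound_linearization[where S = "ball p0 d" and f' = "\<lambda>p. f' p y"])
        show "p0 + t *\<^sub>R (p - p0) \<in> ball p0 d" if "t \<in> {0..1}" for t
          using convexD_alt[OF convex_ball[of p0 d], of p0 p t] pb that d(1)
          by (simp add: algebra_simps)
        show "((\<lambda>p. f p y) has_derivative f' x y) (at x within ball p0 d)" if "x \<in> ball p0 d" for x
          using f'[of x y] that d(2) \<open>y \<in> K\<close> by (blast intro: has_derivative_at_withinI)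
        show "onorm (f' x y - f' p0 y) \<le> e'" if "x \<in> ball p0 d" for x
        proof -
          have "x \<in> U" using that d by blast
          have "f' x y - f' p0 y = blinfun_apply (F (x, y) - F (p0, y))"
            using F[OF \<open>x \<in> U\<close> \<open>y \<in> K\<close>] F[OF \<open>p0 \<in> U\<close> \<open>y \<in> K\<close>]
            by (auto simp: blinfun.diff_left fun_eq_iff)
          then show ?thesis
            using close[of x y] subsetD[OF d(2) that] \<open>y \<in> K\<close> by (simp add: norm_blinfun.rep_eq[symmetric] dist_norm)
        qed
        show "p0 \<in> ball p0 d" using d by simp
      qed
      have int_rem: "set_integrable lborel K (\<lambda>y. f p y - f p0 y - f' p0 y (p - p0))"
        by (intro set_integral_diff int_f int_f' \<open>p \<in> U\<close> \<open>p0 \<in> U\<close>)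
      have int_norm: "set_integrable lborel K (\<lambda>y. norm (f p y - f p0 y - f' p0 y (p - p0)))"
        using integrable_norm[OF int_rem[unfolded set_integrable_def]] by (simp add: set_integrable_def)
      have "(LINT y:K|lborel. f p y) - (LINT y:K|lborel. f p0 y) - (LINT y:K|lborel. f' p0 y (p - p0))
          = (LINT y:K|lborel. f p y - f p0 y - f' p0 y (p - p0))"
        using int_f[OF \<open>p \<in> U\<close>] int_f[OF \<open>p0 \<in> U\<close>] int_f' by (simp add: set_integral_diff)
      also have "norm \<dots> \<le> (LINT y:K|lborel. norm (f p y - f p0 y - f' p0 y (p - p0)))"
        by (rule set_integral_norm_bound[OF int_rem])
      also have "\<dots> \<le> (LINT y:K|lborel. norm (p - p0) * e')"
        by (intro set_integral_mono int_norm pw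
            set_integrable_lborel_compact \<open>compact K\<close> continuous_intros)
      also have "\<dots> = norm (p - p0) * e' * m"
        using emeasure_compact_finite[OF \<open>compact K\<close>] \<open>compact K\<close>
        by (simp add: set_integral_const m_def compact_imp_closed)
      also have "\<dots> \<le> norm (p - p0) * e"
        using \<open>m \<ge> 0\<close> \<open>e > 0\<close> unfolding mult.assoc
        by (intro mult_left_mono) (auto simp: e'_def field_simps)
      finally show ?thesis by (simp add: mult.commute)
    qed
    show "\<exists>d>0. \<forall>p. norm (p - p0) < d \<longrightarrow>
        norm ((LINT y:K|lborel. f p y) - (LINT y:K|lborel. f p0 y) - (LINT y:K|lborel. f' p0 y (p - p0)))
        \<le> e * norm (p - p0)"
      using d(1) main by blast
  qed
qed

section \<open>The two derivatives of a filtered field\<close>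

text \<open>Exchanges a moving ball of integration for a fixed larger one when the kernel vanishes
  on the difference.\<close>

lemma set_integral_zero_extension:
  fixes f :: "'a \<Rightarrow> 'b::{banach, second_countable_topology}"
  assumes "A \<subseteq> B" "\<And>x. x \<in> B - A \<Longrightarrow> f x = 0"
  shows "(LINT x:A|M. f x) = (LINT x:B|M. f x)"
  unfolding set_lebesgue_integral_def
  using assms by (intro Bochner_Integration.integral_cong) (auto simp: indicator_def)

lemma reflect_cball:
  fixes x :: "'a::real_normed_vector"
  shows "(\<lambda>y. x - y) ` cball x R = cball 0 R"
proof
  show "cball 0 R \<subseteq> (\<lambda>y. x - y) ` cball x R"
  proof
    fix z :: 'a assume "z \<in> cball 0 R"
    then show "z \<in> (\<lambda>y. x - y) ` cball x R"
      by (intro image_eqI[of _ _ "x - z"]) (auto simp: dist_norm)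
  qed
qed (auto simp: dist_norm norm_minus_commute)

text \<open>Provides room to move the centre: every ball of radius \<open>R\<close> centred within
  \<open>\<delta>\<close> of \<open>r\<close> stays in \<open>\<Omega>\<close>. The distance from
  \<open>r\<close> to the closed complement is attained, hence exceeds \<open>R\<close>, and half of
  the gap serves as \<open>\<delta>\<close>.\<close>

lemma cball_subset_open_enlarge:
  fixes r :: "'a::heine_borel"
  assumes "open \<Omega>" "cball r R \<subseteq> \<Omega>"
  obtains \<delta> where "\<delta> > 0" "cball r (R + \<delta>) \<subseteq> \<Omega>"
\<comment> \<open>An empty complement has no nearest point, so this case is separate.\<close>
proof (cases "\<Omega> = UNIV")
  case True
  then show ?thesis using that[of 1] by simp
next
  case False
  then obtain c where c: "c \<in> - \<Omega>" "infdist r (- \<Omega>) = dist r c"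
    using infdist_attains_inf[of "- \<Omega>" r] \<open>open \<Omega>\<close> by (auto simp: closed_Compl)
  then have "dist r c > R" using assms(2) by force
  moreover have "cball r (R + (dist r c - R) / 2) \<subseteq> \<Omega>"
  proof
    fix y assume "y \<in> cball r (R + (dist r c - R) / 2)"
    then have "dist r y < dist r c" using \<open>dist r c > R\<close> by (simp add: field_simps)
    then show "y \<in> \<Omega>" using infdist_le[of y "- \<Omega>" r] c(2) by fastforce
  qed
  ultimately show ?thesis using that[of "(dist r c - R) / 2"] by simp
qed

text \<open>The substitution \<open>z = x - y\<close> fixes the domain of integration and moves the
  dependence on \<open>x\<close> into \<open>G\<close>, so that the derivative falls on the field
  and continuity of \<open>w\<close> suffices. Position and time are treated together as one
  parameter.\<close>

lemma has_derivative_filtered_field: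
  fixes G :: "'a::euclidean_space \<times> 'c::euclidean_space \<Rightarrow> 'b::euclidean_space" and w :: "'a \<Rightarrow> real"
  assumes "open \<Omega>" "open I" "cball r R \<subseteq> \<Omega>" "t \<in> I" and cont_w: "continuous_on UNIV w"
    and G': "\<And>q. q \<in> \<Omega> \<times> I \<Longrightarrow> (G has_derivative G' q) (at q)"
    and cont_G': "\<And>v. continuous_on (\<Omega> \<times> I) (\<lambda>q. G' q v)"
  shows "((\<lambda>(x, s). LINT y:cball x R|lborel. w (x - y) *\<^sub>R G (y, s)) has_derivative
           (\<lambda>v. LINT z:cball 0 R|lborel. w z *\<^sub>R G' (r - z, t) v)) (at (r, t))"
proof -
  obtain \<delta> where \<delta>: "\<delta> > 0" "cball r (R + \<delta>) \<subseteq> \<Omega>"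
    using cball_subset_open_enlarge[OF assms(1,3)] .
  define U where "U = ball r \<delta> \<times> I"
  have U: "open U" "(r, t) \<in> U"
    using \<delta>(1) \<open>open I\<close> \<open>t \<in> I\<close> by (auto simp: U_def open_Times)
  have in_\<Omega>: "y \<in> \<Omega>" if "x \<in> ball r \<delta>" "y \<in> cball x R" for x y
    using that \<delta>(2) dist_triangle[of r y x] by (auto simp: subset_iff)
  have in_\<Omega>': "(fst p - z, snd p) \<in> \<Omega> \<times> I" if "p \<in> U" "z \<in> cball 0 R" for p z
    using in_\<Omega>[of "fst p" "fst p - z"] that by (auto simp: U_def dist_norm)
  have cont_G: "continuous_on (\<Omega> \<times> I) G"
    using G' by (meson continuous_at_imp_continuous_on has_derivative_continuous)
  have "((\<lambda>p. LINT z:cball 0 R|lborel. w z *\<^sub>R G (fst p - z, snd p)) has_derivative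
           (\<lambda>v. LINT z:cball 0 R|lborel. w z *\<^sub>R G' (fst (r, t) - z, snd (r, t)) v)) (at (r, t))"
  proof (rule has_derivative_set_integral_compact[OF U])
    fix p z assume pz: "p \<in> U" "z \<in> cball (0::'a) R"
    have "((\<lambda>p. G (fst p - z, snd p)) has_derivative (\<lambda>v. G' (fst p - z, snd p) (fst v - 0, snd v))) (at p)"
      by (rule has_derivative_compose[of "\<lambda>p. (fst p - z, snd p)", OF _ G'[OF in_\<Omega>'[OF pz]]])
        (intro derivative_intros)
    then show "((\<lambda>p. w z *\<^sub>R G (fst p - z, snd p)) has_derivative (\<lambda>v. w z *\<^sub>R G' (fst p - z, snd p) v)) (at p)"
      by (auto intro: has_derivative_scaleR_right)
  next
    fix p assume "p \<in> U"
    show "continuous_on (cball 0 R) (\<lambda>z. w z *\<^sub>R G (fst p - z, snd p))"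
      by (intro continuous_on_scaleR continuous_on_subset[OF cont_w] continuous_on_compose2[OF cont_G]
          continuous_intros) (use in_\<Omega>'[OF \<open>p \<in> U\<close>] in auto)
  next
    fix v
    have "continuous_on (U \<times> cball 0 R) (\<lambda>x. w (snd x) *\<^sub>R G' (fst (fst x) - snd x, snd (fst x)) v)"
      by (intro continuous_on_scaleR continuous_on_compose2[OF cont_w]
          continuous_on_compose2[OF cont_G'] continuous_intros) (use in_\<Omega>' in auto)
    then show "continuous_on (U \<times> cball 0 R) (\<lambda>(p, z). w z *\<^sub>R G' (fst p - z, snd p) v)"
      by (simp add: case_prod_unfold)
  qed simp
  then have deriv: "((\<lambda>p. LINT z:cball 0 R|lborel. w z *\<^sub>R G (fst p - z, snd p)) has_derivative
           (\<lambda>v. LINT z:cball 0 R|lborel. w z *\<^sub>R G' (r - z, t) v)) (at (r, t))"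
    by simp
  show ?thesis
  proof (rule has_derivative_transform_within_open[OF deriv U])
    fix p assume "p \<in> U"
    have cont: "continuous_on (cball (fst p) R) (\<lambda>y. w (fst p - y) *\<^sub>R G (y, snd p))"
      by (intro continuous_on_scaleR continuous_on_compose2[OF cont_w] continuous_on_compose2[OF cont_G]
          continuous_intros) (use in_\<Omega> \<open>p \<in> U\<close> in \<open>auto simp: U_def\<close>)
    show "(LINT z:cball 0 R|lborel. w z *\<^sub>R G (fst p - z, snd p))
        = (case p of (x, s) \<Rightarrow> LINT y:cball x R|lborel. w (x - y) *\<^sub>R G (y, s))"
      using set_integral_lborel_reflect[OF compact_cball cont, of "fst p"]
      by (simp add: case_prod_unfold reflect_cball)
  qed
qed

text \<open>Since \<open>w\<close> vanishes outside radius \<open>R\<close>, the moving ball can be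
  replaced by one fixed ball of radius \<open>R + \<delta>\<close> for all \<open>x\<close> near
  \<open>r\<close>. Then \<open>x\<close> occurs only in \<open>w (x - y)\<close>, and the
  derivative falls on the kernel.\<close>

lemma has_derivative_filtered_kernel:
  fixes G :: "'a::euclidean_space \<Rightarrow> 'b::euclidean_space" and w :: "'a \<Rightarrow> real"
  assumes "open \<Omega>" "cball r R \<subseteq> \<Omega>" and cont_G: "continuous_on \<Omega> G"
    and w': "\<And>x. (w has_derivative w' x) (at x)"
    and cont_w': "\<And>v. continuous_on UNIV (\<lambda>x. w' x v)"
    and supp: "\<And>x. norm x > R \<Longrightarrow> w x = 0"
  shows "((\<lambda>x. LINT y:cball x R|lborel. w (x - y) *\<^sub>R G y) has_derivative
           (\<lambda>v. LINT y:cball r R|lborel. w' (r - y) v *\<^sub>R G y)) (at r)"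
proof -
  obtain \<delta> where \<delta>: "\<delta> > 0" "cball r (R + \<delta>) \<subseteq> \<Omega>"
    using cball_subset_open_enlarge[OF assms(1,2)] .
  let ?K = "cball r (R + \<delta>)"
  have cont_w: "continuous_on UNIV w"
    using w' by (meson continuous_at_imp_continuous_on has_derivative_continuous)
  \<comment> \<open>Beyond radius \<open>R\<close> the kernel is zero on an open set, so its
    derivative vanishes there by uniqueness.\<close>
  have supp': "w' x v = 0" if "norm x > R" for x v
  proof -
    have "open {x::'a. norm x > R}" by (intro open_Collect_less continuous_intros)
    then have "((\<lambda>_. 0) has_derivative w' x) (at x)"
      by (rule has_derivative_transform_within_open[OF w']) (use that supp in auto)
    then have "w' x = (\<lambda>_. 0)"
      using has_derivative_unique[OF _ has_derivative_const] by blast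
    then show ?thesis by simp
  qed
  have "((\<lambda>x. LINT y:?K|lborel. w (x - y) *\<^sub>R G y) has_derivative
           (\<lambda>v. LINT y:?K|lborel. w' (r - y) v *\<^sub>R G y)) (at r)"
  proof (rule has_derivative_set_integral_compact[of "ball r \<delta>"])
    fix x y assume "y \<in> ?K"
    have "((\<lambda>x. w (x - y)) has_derivative (\<lambda>v. w' (x - y) (v - 0))) (at x)"
      by (rule has_derivative_compose[of "\<lambda>x. x - y", OF _ w']) (intro derivative_intros)
    then show "((\<lambda>x. w (x - y) *\<^sub>R G y) has_derivative (\<lambda>v. w' (x - y) v *\<^sub>R G y)) (at x)"
      by (auto intro: has_derivative_scaleR_left)
  next
    fix x
    show "continuous_on ?K (\<lambda>y. w (x - y) *\<^sub>R G y)"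
      by (intro continuous_on_scaleR continuous_on_compose2[OF cont_w]
          continuous_on_subset[OF cont_G \<delta>(2)] continuous_intros) auto
  next
    fix v
    have "continuous_on (ball r \<delta> \<times> ?K) (\<lambda>x. w' (fst x - snd x) v *\<^sub>R G (snd x))"
      by (intro continuous_on_scaleR continuous_on_compose2[OF cont_w']
          continuous_on_compose2[OF cont_G] continuous_intros) (use \<delta>(2) in auto)
    then show "continuous_on (ball r \<delta> \<times> ?K) (\<lambda>(x, y). w' (x - y) v *\<^sub>R G y)"
      by (simp add: case_prod_unfold)
  qed (use \<delta>(1) in auto)
  \<comment> \<open>The derivative of the kernel has the same support bound, so the integral shrinks
    back to the ball of radius \<open>R\<close>.\<close>
  moreover have "(LINT y:cball r R|lborel. w' (r - y) v *\<^sub>R G y) = (LINT y:?K|lborel. w' (r - y) v *\<^sub>R G y)" for v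
    by (rule set_integral_zero_extension) (use \<delta>(1) supp' in \<open>auto simp: dist_norm\<close>)
  ultimately have deriv: "((\<lambda>x. LINT y:?K|lborel. w (x - y) *\<^sub>R G y) has_derivative
           (\<lambda>v. LINT y:cball r R|lborel. w' (r - y) v *\<^sub>R G y)) (at r)"
    by simp
  show ?thesis
  proof (rule has_derivative_transform_within_open[OF deriv open_ball])
    show "r \<in> ball r \<delta>" using \<delta>(1) by simp
    fix x assume "x \<in> ball r \<delta>"
    show "(LINT y:?K|lborel. w (x - y) *\<^sub>R G y) = (LINT y:cball x R|lborel. w (x - y) *\<^sub>R G y)"
    proof (rule set_integral_zero_extension[symmetric])
      show "cball x R \<subseteq> ?K"
      proof
        fix y assume "y \<in> cball x R"
        then show "y \<in> ?K" using \<open>x \<in> ball r \<delta>\<close> dist_triangle[of r y x] by simp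
      qed
    qed (use supp in \<open>auto simp: dist_norm\<close>)
  qed
qed

section \<open>Partial derivatives, gradient and divergence in coordinates\<close>

lemma has_derivative_partial:
  assumes "(G has_derivative G') (at (x, t))"
  shows has_derivative_partial_fst: "((\<lambda>x. G (x, t)) has_derivative (\<lambda>v. G' (v, 0))) (at x)"
    and has_derivative_partial_snd: "((\<lambda>s. G (x, s)) has_derivative (\<lambda>\<tau>. G' (0, \<tau>))) (at t)"
proof -
  show "((\<lambda>x. G (x, t)) has_derivative (\<lambda>v. G' (v, 0))) (at x)"
    by (rule has_derivative_compose[of "\<lambda>x. (x, t)", OF _ assms]) (intro derivative_intros)
  show "((\<lambda>s. G (x, s)) has_derivative (\<lambda>\<tau>. G' (0, \<tau>))) (at t)"
    by (rule has_derivative_compose[of "\<lambda>s. (x, s)", OF _ assms]) (intro derivative_intros)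
qed

lemma smooth_on_C1:
  assumes "smooth_on S f"
  shows smooth_on_has_derivative: "\<And>x. x \<in> S \<Longrightarrow> (f has_derivative frechet_derivative f (at x)) (at x)"
    and smooth_on_continuous_derivative: "\<And>v. continuous_on S (\<lambda>x. frechet_derivative f (at x) v)"
proof -
  have "Ck_on (Suc 0) S f" using assms by (simp only: smooth_on_def)
  then show "\<And>x. x \<in> S \<Longrightarrow> (f has_derivative frechet_derivative f (at x)) (at x)"
    and "\<And>v. continuous_on S (\<lambda>x. frechet_derivative f (at x) v)"
    by (auto simp: frechet_derivative_works)
qed

text \<open>A linear map on the reals is multiplication by its value at 1.\<close>

lemma deriv_eq_has_derivative:
  fixes f :: "real \<Rightarrow> real"
  assumes "(f has_derivative f') (at t)"
  shows "deriv f t = f' 1"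
proof -
  have "f' = (*) (f' 1)"
  proof
    show "f' \<tau> = f' 1 * \<tau>" for \<tau>
      using linear_scale[OF has_derivative_linear[OF assms], of \<tau> 1] by (simp add: mult.commute)
  qed
  then show ?thesis
    using assms by (metis DERIV_imp_deriv has_field_derivative_def)
qed

lemma gradient_eq_has_derivative:
  assumes "(f has_derivative f') (at x)"
  shows "gradient f x = (\<chi> i. f' (axis i 1))"
  using assms by (simp add: gradient_def frechet_derivative_at[OF assms, symmetric])

lemma divergence_eq_has_derivative:
  assumes "(f has_derivative f') (at x)"
  shows "divergence f x = (\<Sum>i\<in>UNIV. f' (axis i 1) $ i)"
  using assms by (simp add: divergence_def frechet_derivative_at[OF assms, symmetric])

text \<open>Moves a divergence through the integral: \<open>f i\<close> stands for the derivative of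
  a vector field in direction \<open>i\<close>, so the sum of the diagonal components is a
  trace.\<close>

lemma set_integral_trace:
  fixes f :: "'n::finite \<Rightarrow> 'a \<Rightarrow> real ^ 'n"
  assumes "\<And>i. set_integrable M A (f i)"
  shows "(LINT x:A|M. (\<Sum>i\<in>UNIV. f i x $ i)) = (\<Sum>i\<in>UNIV. (LINT x:A|M. f i x) $ i)"
    and "set_integrable M A (\<lambda>x. \<Sum>i\<in>UNIV. f i x $ i)"
proof -
  have int: "set_integrable M A (\<lambda>x. f i x $ i)" for i
    using integrable_bounded_linear[OF bounded_linear_vec_nth[of i] assms[of i, unfolded set_integrable_def]]
    by (simp add: set_integrable_def)
  show "(LINT x:A|M. (\<Sum>i\<in>UNIV. f i x $ i)) = (\<Sum>i\<in>UNIV. (LINT x:A|M. f i x) $ i)"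
    using set_integral_bounded_linear[OF bounded_linear_vec_nth assms]
    by (subst set_integral_sum) (auto simp: int)
  show "set_integrable M A (\<lambda>x. \<Sum>i\<in>UNIV. f i x $ i)"
    using int unfolding set_integrable_def scaleR_sum_right by (intro Bochner_Integration.integrable_sum)
qed

section \<open>The filtered continuity equation\<close>

text \<open>\<open>deriv\<close>, \<open>gradient\<close> and \<open>divergence\<close> are total
  and return some value even where no derivative exists. The two differentiability conjuncts ensure
  that both equations speak about genuine derivatives.\<close>

theorem mainTheorem1:
  fixes \<Omega> :: "(real ^ 'n) set" and I :: "real set" and h \<kappa> :: real
    and w :: "real ^ 'n \<Rightarrow> real"
    and \<rho> :: "real ^ 'n \<Rightarrow> real \<Rightarrow> real"
    and u :: "real ^ 'n \<Rightarrow> real \<Rightarrow> real ^ 'n"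
  defines "\<rho>h \<equiv> filtered_density \<kappa> h w \<rho>"
    and "uh \<equiv> filtered_velocity \<kappa> h w \<rho> u"
  assumes "open \<Omega>" and "open I" and "is_interval I"
    and "h > 0" and "\<kappa> > 0"
    and "filter_kernel \<kappa> h w"
    and "smooth_on (\<Omega> \<times> I) (\<lambda>(r, t). \<rho> r t)"
    and "smooth_on (\<Omega> \<times> I) (\<lambda>(r, t). u r t)"
    and "\<forall>r\<in>\<Omega>. \<forall>t\<in>I. \<rho> r t > 0"
    and "\<forall>r\<in>\<Omega>. \<forall>t\<in>I.
           deriv (\<lambda>s. \<rho> r s) t + u r t \<bullet> gradient (\<lambda>x. \<rho> x t) r
             = - \<rho> r t * divergence (\<lambda>x. u x t) r"
  shows "\<forall>r\<in>interior_domain \<kappa> h \<Omega>. \<forall>t\<in>I.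
           (\<lambda>(x, s). \<rho>h x s) differentiable (at (r, t)) \<and>
           (\<lambda>x. uh x t) differentiable (at r) \<and>
           material_derivative uh \<rho>h r t
             = (LINT r':test_space \<kappa> h r|lborel.
                  \<rho> r' t * ((uh r t - u r' t) \<bullet> gradient (\<lambda>x. w (x - r')) r)) \<and>
           material_derivative uh \<rho>h r t = - \<rho>h r t * divergence (\<lambda>x. uh x t) r"
proof (intro ballI)
  fix r t assume "r \<in> interior_domain \<kappa> h \<Omega>" and t: "t \<in> I"
  define R where "R = \<kappa> * h"
  have test_space: "test_space \<kappa> h x = cball x R" for x :: "real ^ 'n"
    by (auto simp: test_space_def R_def dist_norm)
  have sub: "cball r R \<subseteq> \<Omega>"
    using \<open>r \<in> interior_domain \<kappa> h \<Omega>\<close> by (simp add: interior_domain_def test_space)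
  have refl_ball: "r - z \<in> \<Omega>" if "z \<in> cball 0 R" for z
    using that sub by (auto simp: subset_iff dist_norm)

  have smooth_w: "smooth_on UNIV w" and w_nonneg: "w x \<ge> 0" and w_int: "(\<integral>x. w x \<partial>lborel) = 1"
    and supp_cl: "closure {x. w x \<noteq> 0} \<subseteq> cball 0 R" for x
    using \<open>filter_kernel \<kappa> h w\<close> by (auto simp: filter_kernel_def R_def)
  have supp: "w x = 0" if "norm x > R" for x
    using supp_cl closure_subset[of "{x. w x \<noteq> 0}"] that by (force simp: subset_iff)
  define w' where "w' = (\<lambda>x. frechet_derivative w (at x))"
  have w': "(w has_derivative w' x) (at x)" for x
    using smooth_on_has_derivative[OF smooth_w] by (simp add: w'_def)
  have cont_w': "continuous_on UNIV (\<lambda>x. w' x v)" for v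
    using smooth_on_continuous_derivative[OF smooth_w] by (simp add: w'_def)
  have cont_w: "continuous_on UNIV w"
    using w' by (meson continuous_at_imp_continuous_on has_derivative_continuous)

  define \<rho>' where "\<rho>' = (\<lambda>q. frechet_derivative (\<lambda>(r, t). \<rho> r t) (at q))"
  define u' where "u' = (\<lambda>q. frechet_derivative (\<lambda>(r, t). u r t) (at q))"
  \<comment> \<open>The momentum density on space-time; \<open>P'\<close> is its derivative by the
    product rule.\<close>
  define P where "P = (\<lambda>(r, t). \<rho> r t *\<^sub>R u r t)"
  define P' where "P' = (\<lambda>q v. \<rho> (fst q) (snd q) *\<^sub>R u' q v + \<rho>' q v *\<^sub>R u (fst q) (snd q))"
  have \<rho>': "((\<lambda>(r, t). \<rho> r t) has_derivative \<rho>' q) (at q)" if "q \<in> \<Omega> \<times> I" for q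
    using smooth_on_has_derivative[OF \<open>smooth_on (\<Omega> \<times> I) (\<lambda>(r, t). \<rho> r t)\<close> that] by (simp add: \<rho>'_def)
  have u': "((\<lambda>(r, t). u r t) has_derivative u' q) (at q)" if "q \<in> \<Omega> \<times> I" for q
    using smooth_on_has_derivative[OF \<open>smooth_on (\<Omega> \<times> I) (\<lambda>(r, t). u r t)\<close> that] by (simp add: u'_def)
  have P': "(P has_derivative P' q) (at q)" if "q \<in> \<Omega> \<times> I" for q
    using has_derivative_scaleR[OF \<rho>'[OF that] u'[OF that]]
    by (simp add: P_def P'_def case_prod_unfold)
  have cont_\<rho>': "continuous_on (\<Omega> \<times> I) (\<lambda>q. \<rho>' q v)" for v
    using smooth_on_continuous_derivative[OF \<open>smooth_on (\<Omega> \<times> I) (\<lambda>(r, t). \<rho> r t)\<close>] by (simp add: \<rho>'_def)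
  have cont_u': "continuous_on (\<Omega> \<times> I) (\<lambda>q. u' q v)" for v
    using smooth_on_continuous_derivative[OF \<open>smooth_on (\<Omega> \<times> I) (\<lambda>(r, t). u r t)\<close>] by (simp add: u'_def)
  have cont_\<rho>: "continuous_on (\<Omega> \<times> I) (\<lambda>q. \<rho> (fst q) (snd q))"
    using \<rho>' unfolding case_prod_unfold by (meson continuous_at_imp_continuous_on has_derivative_continuous)
  have cont_u: "continuous_on (\<Omega> \<times> I) (\<lambda>q. u (fst q) (snd q))"
    using u' unfolding case_prod_unfold by (meson continuous_at_imp_continuous_on has_derivative_continuous)
  have cont_P': "continuous_on (\<Omega> \<times> I) (\<lambda>q. P' q v)" for v
    unfolding P'_def by (intro continuous_intros cont_\<rho> cont_u cont_\<rho>' cont_u')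
  have cont_pair: "continuous_on \<Omega> (\<lambda>y. (y, t))"
    by (intro continuous_intros)
  have cont_\<rho>t: "continuous_on \<Omega> (\<lambda>y. \<rho> y t)"
    using continuous_on_compose2[OF cont_\<rho> cont_pair] t by auto
  have cont_ut: "continuous_on \<Omega> (\<lambda>y. u y t)"
    using continuous_on_compose2[OF cont_u cont_pair] t by auto

  define m where "m = (\<lambda>x s. LINT y:cball x R|lborel. w (x - y) *\<^sub>R P (y, s))"
  \<comment> \<open>The \<open>case\<close> on the pair makes the integrand a literal instance of
    the field \<open>G\<close> in \<open>has_derivative_filtered_field\<close>.\<close>
  have \<rho>h: "\<rho>h x s = (LINT y:cball x R|lborel. w (x - y) *\<^sub>R (case (y, s) of (r, t) \<Rightarrow> \<rho> r t))" for x s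
    by (simp add: \<rho>h_def filtered_density_def test_space mult.commute)
  have uh: "uh x s = m x s /\<^sub>R \<rho>h x s" for x s
    by (simp add: uh_def filtered_velocity_def test_space m_def P_def \<rho>h_def mult.commute)

  \<comment> \<open>\<open>L\<close> and \<open>M\<close> are the space-time derivatives of filtered
    density and filtered momentum, with the derivative on the fields. Arguments
    \<open>(v, 0)\<close> give spatial derivatives and \<open>(0, 1)\<close> the time
    derivative.\<close>
  define L where "L = (\<lambda>v. LINT z:cball 0 R|lborel. w z *\<^sub>R \<rho>' (r - z, t) v)"
  define M where "M = (\<lambda>v. LINT z:cball 0 R|lborel. w z *\<^sub>R P' (r - z, t) v)"
  have L: "((\<lambda>(x, s). \<rho>h x s) has_derivative L) (at (r, t))"
    unfolding \<rho>h L_def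
    by (rule has_derivative_filtered_field[OF \<open>open \<Omega>\<close> \<open>open I\<close> sub t cont_w \<rho>' cont_\<rho>'])
  have M: "((\<lambda>(x, s). m x s) has_derivative M) (at (r, t))"
    unfolding m_def M_def
    by (rule has_derivative_filtered_field[OF \<open>open \<Omega>\<close> \<open>open I\<close> sub t cont_w P' cont_P'])
  have Lx: "((\<lambda>x. \<rho>h x t) has_derivative (\<lambda>v. L (v, 0))) (at r)"
    and Lt: "((\<lambda>s. \<rho>h r s) has_derivative (\<lambda>\<tau>. L (0, \<tau>))) (at t)"
    using has_derivative_partial[OF L] by simp_all
  have Mx: "((\<lambda>x. m x t) has_derivative (\<lambda>v. M (v, 0))) (at r)"
    using has_derivative_partial_fst[OF M] by simp

  \<comment> \<open>Both filtered-field lemmas give a derivative of the same function at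
    \<open>r\<close>, so the two expressions agree. Here and in \<open>M_kernel\<close> this
    transfers the derivative from the field to the kernel.\<close>
  have L_kernel: "L (v, 0) = (LINT y:cball r R|lborel. w' (r - y) v *\<^sub>R \<rho> y t)" for v
  proof -
    have "((\<lambda>x. \<rho>h x t) has_derivative (\<lambda>v. LINT y:cball r R|lborel. w' (r - y) v *\<^sub>R \<rho> y t)) (at r)"
      using has_derivative_filtered_kernel[OF \<open>open \<Omega>\<close> sub cont_\<rho>t w' cont_w' supp] by (simp add: \<rho>h)
    from has_derivative_unique[OF Lx this] show ?thesis by (rule fun_cong)
  qed
  have M_kernel: "M (v, 0) = (LINT y:cball r R|lborel. w' (r - y) v *\<^sub>R (\<rho> y t *\<^sub>R u y t))" for v
  proof -
    have "((\<lambda>x. m x t) has_derivative (\<lambda>v. LINT y:cball r R|lborel. w' (r - y) v *\<^sub>R (\<rho> y t *\<^sub>R u y t))) (at r)"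
      using has_derivative_filtered_kernel[OF \<open>open \<Omega>\<close> sub continuous_on_scaleR[OF cont_\<rho>t cont_ut] w' cont_w' supp]
      by (simp add: m_def P_def)
    from has_derivative_unique[OF Mx this] show ?thesis by (rule fun_cong)
  qed

  \<comment> \<open>Conservation form of the continuity equation: the divergence of \<rho> u is
    \<rho> div u + u . grad \<rho>.\<close>
  have continuity: "\<rho>' (y, t) (0, 1) + (\<Sum>i\<in>UNIV. P' (y, t) (axis i 1, 0) $ i) = 0" if "y \<in> \<Omega>" for y
  proof -
    have yt: "(y, t) \<in> \<Omega> \<times> I" using that t by simp
    have "deriv (\<lambda>s. \<rho> y s) t = \<rho>' (y, t) (0, 1)"
      using deriv_eq_has_derivative[OF has_derivative_partial_snd[OF \<rho>'[OF yt]]] by simp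
    moreover have "gradient (\<lambda>x. \<rho> x t) y = (\<chi> i. \<rho>' (y, t) (axis i 1, 0))"
      using gradient_eq_has_derivative[OF has_derivative_partial_fst[OF \<rho>'[OF yt]]] by simp
    moreover have "divergence (\<lambda>x. u x t) y = (\<Sum>i\<in>UNIV. u' (y, t) (axis i 1, 0) $ i)"
      using divergence_eq_has_derivative[OF has_derivative_partial_fst[OF u'[OF yt]]] by simp
    moreover have "deriv (\<lambda>s. \<rho> y s) t + u y t \<bullet> gradient (\<lambda>x. \<rho> x t) y
             = - \<rho> y t * divergence (\<lambda>x. u x t) y"
      using assms(12) that t by blast
    moreover have "(\<Sum>i\<in>UNIV. P' (y, t) (axis i 1, 0) $ i)
        = \<rho> y t * (\<Sum>i\<in>UNIV. u' (y, t) (axis i 1, 0) $ i) + (\<Sum>i\<in>UNIV. u y t $ i * \<rho>' (y, t) (axis i 1, 0))"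
      by (simp add: P'_def sum.distrib sum_distrib_left mult.commute)
    ultimately show ?thesis
      by (simp add: inner_vec_def)
  qed
  \<comment> \<open>The conservation form holds at every \<open>r - z\<close> in the test space;
    weighting it by \<open>w z\<close> and integrating gives the same balance for the filtered
    density and momentum.\<close>
  have mass: "L (0, 1) + (\<Sum>i\<in>UNIV. M (axis i 1, 0) $ i) = 0"
  proof -
    have cont_refl: "continuous_on (cball 0 R) (\<lambda>z. (r - z, t))"
      by (intro continuous_intros)
    have img: "(\<lambda>z. (r - z, t)) ` cball 0 R \<subseteq> \<Omega> \<times> I"
      using refl_ball t by auto
    have int_\<rho>: "set_integrable lborel (cball 0 R) (\<lambda>z. w z *\<^sub>R \<rho>' (r - z, t) v)" for v
      by (intro set_integrable_lborel_compact compact_cball continuous_on_scaleR continuous_on_subset[OF cont_w]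
          continuous_on_compose2[OF cont_\<rho>' cont_refl img]) simp
    have int_P: "set_integrable lborel (cball 0 R) (\<lambda>z. w z *\<^sub>R P' (r - z, t) v)" for v
      by (intro set_integrable_lborel_compact compact_cball continuous_on_scaleR continuous_on_subset[OF cont_w]
          continuous_on_compose2[OF cont_P' cont_refl img]) simp
    have "L (0, 1) + (\<Sum>i\<in>UNIV. M (axis i 1, 0) $ i)
        = (LINT z:cball 0 R|lborel. w z *\<^sub>R \<rho>' (r - z, t) (0, 1)
             + (\<Sum>i\<in>UNIV. (w z *\<^sub>R P' (r - z, t) (axis i 1, 0)) $ i))"
      unfolding L_def M_def
      by (simp only: set_integral_add(2)[OF int_\<rho> set_integral_trace(2)[OF int_P]] set_integral_trace(1)[OF int_P])
    also have "\<dots> = (LINT z:cball (0 :: real ^ 'n) R|lborel. 0)"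
    proof (rule set_lebesgue_integral_cong)
      show "\<forall>z. z \<in> cball 0 R \<longrightarrow> w z *\<^sub>R \<rho>' (r - z, t) (0, 1)
             + (\<Sum>i\<in>UNIV. (w z *\<^sub>R P' (r - z, t) (axis i 1, 0)) $ i) = 0"
      proof (intro allI impI)
        fix z :: "real ^ 'n" assume "z \<in> cball 0 R"
        have "w z *\<^sub>R \<rho>' (r - z, t) (0, 1) + (\<Sum>i\<in>UNIV. (w z *\<^sub>R P' (r - z, t) (axis i 1, 0)) $ i)
            = w z * (\<rho>' (r - z, t) (0, 1) + (\<Sum>i\<in>UNIV. P' (r - z, t) (axis i 1, 0) $ i))"
          by (simp add: sum_distrib_left distrib_left)
        then show "w z *\<^sub>R \<rho>' (r - z, t) (0, 1) + (\<Sum>i\<in>UNIV. (w z *\<^sub>R P' (r - z, t) (axis i 1, 0)) $ i) = 0"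
          using continuity[OF refl_ball[OF \<open>z \<in> cball 0 R\<close>]] by simp
      qed
    qed simp
    finally show ?thesis by (simp add: set_lebesgue_integral_def)
  qed

  \<comment> \<open>The kernel has total mass one on the ball, so the filtered density is at least
    the minimum of \<rho> over the compact test space, which is attained and positive.\<close>
  have "\<rho>h r t > 0"
  proof -
    have int_w: "integrable lborel w"
      using w_int not_integrable_integral_eq by fastforce
    have nonempty: "cball r R \<noteq> {}"
      using mult_pos_pos[OF \<open>\<kappa> > 0\<close> \<open>h > 0\<close>] by (simp add: R_def)
    obtain y0 where y0: "y0 \<in> cball r R" "\<And>y. y \<in> cball r R \<Longrightarrow> \<rho> y0 t \<le> \<rho> y t"
      using continuous_attains_inf[OF compact_cball nonempty continuous_on_subset[OF cont_\<rho>t sub]] by blast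
    have "\<rho> y0 t > 0" using assms(11) y0(1) sub t by blast
    have cont_wr: "continuous_on (cball r R) (\<lambda>y. w (r - y))"
      by (intro continuous_on_compose2[OF cont_w] continuous_intros) simp
    have "1 = (LINT z:UNIV|lborel. w z)"
      using w_int by (simp add: set_lebesgue_integral_def)
    also have "\<dots> = (LINT z:cball 0 R|lborel. w z)"
      by (rule set_integral_zero_extension[symmetric]) (use supp in auto)
    also have "\<dots> = (LINT y:cball r R|lborel. w (r - y))"
      using set_integral_lborel_reflect[OF compact_cball cont_wr, of r] by (simp add: reflect_cball)
    finally have "\<rho> y0 t = (LINT y:cball r R|lborel. w (r - y) * \<rho> y0 t)"
      by simp
    also have "\<dots> \<le> (LINT y:cball r R|lborel. w (r - y) * \<rho> y t)"
      by (intro set_integral_mono set_integrable_lborel_compact compact_cball continuous_on_mult cont_wr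
          continuous_on_const continuous_on_subset[OF cont_\<rho>t sub] mult_left_mono y0(2) w_nonneg)
    finally show ?thesis using \<open>\<rho> y0 t > 0\<close> by (simp add: \<rho>h)
  qed
  then have \<rho>h_nz: "\<rho>h r t \<noteq> 0" by simp

  \<comment> \<open>\<open>a\<close> collects the components of the gradient of the filtered
    density, and \<open>A\<close> is the divergence of the filtered momentum. Both sides of each
    claimed equation reduce to uh . a - A.\<close>
  define a where "a = (\<lambda>i. L (axis i 1, 0))"
  define A where "A = (\<Sum>i\<in>UNIV. M (axis i 1, 0) $ i)"
  have grad_\<rho>h: "gradient (\<lambda>x. \<rho>h x t) r = (\<chi> i. a i)"
    by (simp add: gradient_eq_has_derivative[OF Lx] a_def)
  \<comment> \<open>By \<open>mass\<close>, the time derivative of the filtered density is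
    \<open>- A\<close>.\<close>
  have material: "material_derivative uh \<rho>h r t = (\<Sum>i\<in>UNIV. uh r t $ i * a i) - A"
    using mass by (simp add: material_derivative_def deriv_eq_has_derivative[OF Lt] grad_\<rho>h inner_vec_def A_def)

  \<comment> \<open>Quotient rule for \<open>m / \<rho>h\<close>. In its trace, one factor
    \<open>m / \<rho>h\<close> is recognized as \<open>uh\<close> again.\<close>
  define U' where "U' = (\<lambda>v. M (v, 0) /\<^sub>R \<rho>h r t - (L (v, 0) / (\<rho>h r t)\<^sup>2) *\<^sub>R m r t)"
  have U': "((\<lambda>x. uh x t) has_derivative U') (at r)"
    unfolding uh U'_def
    by (rule has_derivative_eq_rhs[OF has_derivative_scaleR[OF Deriv.has_derivative_inverse[OF \<rho>h_nz Lx] Mx]])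
      (simp add: fun_eq_iff power2_eq_square divide_inverse)
  have div_uh: "divergence (\<lambda>x. uh x t) r = A / \<rho>h r t - (\<Sum>i\<in>UNIV. uh r t $ i * a i) / \<rho>h r t"
    unfolding divergence_eq_has_derivative[OF U'] U'_def A_def a_def uh[of r t]
    by (simp add: sum_subtractf sum_divide_distrib divide_inverse power2_eq_square sum_distrib_left mult_ac)

  \<comment> \<open>The integrand splits into two parts. In the first, \<open>uh r t\<close> does
    not depend on \<open>y\<close> and leaves the integral, which gives uh . a by
    \<open>L_kernel\<close>; the second is the divergence \<open>A\<close> by
    \<open>M_kernel\<close>.\<close>
  have integral_form: "(LINT y:cball r R|lborel. \<rho> y t * ((uh r t - u y t) \<bullet> gradient (\<lambda>x. w (x - y)) r))
      = (\<Sum>i\<in>UNIV. uh r t $ i * a i) - A"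
  proof -
    have grad_w: "gradient (\<lambda>x. w (x - y)) r = (\<chi> i. w' (r - y) (axis i 1))" for y
    proof -
      have "((\<lambda>x. w (x - y)) has_derivative (\<lambda>v. w' (r - y) (v - 0))) (at r)"
        by (rule has_derivative_compose[of "\<lambda>x. x - y", OF _ w']) (intro derivative_intros)
      from gradient_eq_has_derivative[OF this] show ?thesis by simp
    qed
    have cont_w'r: "continuous_on (cball r R) (\<lambda>y. w' (r - y) v)" for v
      by (intro continuous_on_compose2[OF cont_w'] continuous_intros) simp
    have int_\<rho>: "set_integrable lborel (cball r R) (\<lambda>y. uh r t $ i * (w' (r - y) (axis i 1) *\<^sub>R \<rho> y t))" for i
      by (intro set_integrable_lborel_compact compact_cball continuous_on_mult continuous_on_const
          continuous_on_scaleR cont_w'r continuous_on_subset[OF cont_\<rho>t sub])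
    have int_P: "set_integrable lborel (cball r R) (\<lambda>y. w' (r - y) (axis i 1) *\<^sub>R (\<rho> y t *\<^sub>R u y t))" for i
      by (intro set_integrable_lborel_compact compact_cball continuous_on_scaleR cont_w'r
          continuous_on_subset[OF cont_\<rho>t sub] continuous_on_subset[OF cont_ut sub])
    have "\<rho> y t * ((uh r t - u y t) \<bullet> gradient (\<lambda>x. w (x - y)) r)
        = (\<Sum>i\<in>UNIV. uh r t $ i * (w' (r - y) (axis i 1) *\<^sub>R \<rho> y t))
          - (\<Sum>i\<in>UNIV. (w' (r - y) (axis i 1) *\<^sub>R (\<rho> y t *\<^sub>R u y t)) $ i)" for y
      by (simp add: grad_w inner_vec_def sum_distrib_left sum_subtractf[symmetric] algebra_simps)
    moreover have "set_integrable lborel (cball r R) (\<lambda>y. \<Sum>i\<in>UNIV. uh r t $ i * (w' (r - y) (axis i 1) *\<^sub>R \<rho> y t))"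
      using int_\<rho> unfolding set_integrable_def scaleR_sum_right by (intro Bochner_Integration.integrable_sum)
    ultimately have "(LINT y:cball r R|lborel. \<rho> y t * ((uh r t - u y t) \<bullet> gradient (\<lambda>x. w (x - y)) r))
        = (\<Sum>i\<in>UNIV. LINT y:cball r R|lborel. uh r t $ i * (w' (r - y) (axis i 1) *\<^sub>R \<rho> y t))
          - (\<Sum>i\<in>UNIV. (LINT y:cball r R|lborel. w' (r - y) (axis i 1) *\<^sub>R (\<rho> y t *\<^sub>R u y t)) $ i)"
      by (simp only: set_integral_diff(2)[OF _ set_integral_trace(2)[OF int_P]]
          set_integral_trace(1)[OF int_P] set_integral_sum[OF int_\<rho>])
    then show ?thesis
      by (simp add: A_def a_def M_kernel L_kernel)
  qed

  show "(\<lambda>(x, s). \<rho>h x s) differentiable (at (r, t)) \<and>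
           (\<lambda>x. uh x t) differentiable (at r) \<and>
           material_derivative uh \<rho>h r t
             = (LINT r':test_space \<kappa> h r|lborel.
                  \<rho> r' t * ((uh r t - u r' t) \<bullet> gradient (\<lambda>x. w (x - r')) r)) \<and>
           material_derivative uh \<rho>h r t = - \<rho>h r t * divergence (\<lambda>x. uh x t) r"
  proof (intro conjI)
    show "(\<lambda>(x, s). \<rho>h x s) differentiable (at (r, t))"
      using L by (rule differentiableI)
    show "(\<lambda>x. uh x t) differentiable (at r)"
      using U' by (rule differentiableI)
    show "material_derivative uh \<rho>h r t
             = (LINT r':test_space \<kappa> h r|lborel.
                  \<rho> r' t * ((uh r t - u r' t) \<bullet> gradient (\<lambda>x. w (x - r')) r))"
      by (simp only: material test_space integral_form)
    show "material_derivative uh \<rho>h r t = - \<rho>h r t * divergence (\<lambda>x. uh x t) r"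
      using \<rho>h_nz by (simp add: material div_uh field_simps)
  qed
qed

end
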